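(* Let $G$ be a finite abelian group of order $n\ge 2$ and let $t\ge 2$ be an integer. Then $$\left(\frac{t!}{2^t}n\right)^{1/t}-\frac t2 < w(G,t) < \left(\left\lfloor\frac t2\right\rfloor!\,n\right)^{1/\lfloor t/2\rfloor}+\frac t2.$$
   Context: $G$ is written additively. For a non-negative integer $t$, a subset $A=\{a_1,\dots,a_m\}$ of $G$ (with $m\ge 1$) is called weakly $t$-independent if whenever $\lambda_1a_1+\cdots+\lambda_ma_m=0$ for integers $\lambda_1,\dots,\lambda_m\in\{-1,0,1\}$ with $|\lambda_1|+\cdots+|\lambda_m|\le t$, we have $\lambda_1=\cdots=\lambda_m=0$. $w(G,t)$ denotes the maximum size of a weakly $t$-independent subset of $G$. *)

theory Defs
  imports Complex_Main "HOL-Algebra.Group" "HOL-Algebra.Coset" "HOL-Algebra.FiniteProduct"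
begin

(* Abelian groups are HOL-Algebra's comm_group, which is written multiplicatively:
   the product of the powers a [^] c a below is the sum of the multiples c a * a
   in additive notation. Only the values of c on A matter. *)
definition weakly_independent :: "('a, 'b) monoid_scheme \<Rightarrow> nat \<Rightarrow> 'a set \<Rightarrow> bool" where
  "weakly_independent G t A \<longleftrightarrow>
     A \<subseteq> carrier G \<and> finite A \<and> A \<noteq> {} \<and>
     (\<forall>c :: 'a \<Rightarrow> int.
        (\<forall>a\<in>A. c a \<in> {-1, 0, 1}) \<longrightarrow>
        (\<Sum>a\<in>A. \<bar>c a\<bar>) \<le> int t \<longrightarrow>
        (\<Otimes>\<^bsub>G\<^esub>a\<in>A. a [^]\<^bsub>G\<^esub> c a) = \<one>\<^bsub>G\<^esub> \<longrightarrow>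
        (\<forall>a\<in>A. c a = 0))"

(* The maximum is meaningful for finite G of order at least 2: a singleton of a
   non-identity element is weakly t-independent. For the trivial group with t > 0
   there is no such set and the value is unspecified. *)
definition max_weakly_independent :: "('a, 'b) monoid_scheme \<Rightarrow> nat \<Rightarrow> nat" where
  "max_weakly_independent G t = Max (card ` {A. weakly_independent G t A})"

end

theory Submission
  imports Defs
begin

text \<open>
  Put \<open>s = t div 2\<close>. The sums of the \<open>s\<close>-element subsets of a weakly \<open>t\<close>-independent set of size
  \<open>m\<close> are pairwise distinct, because the difference of two equal ones would be a relation of weight
  at most \<open>2 s \<le> t\<close>; so \<open>(m choose s) \<le> n\<close>, while \<open>(m - s + 1)^s \<le> s! (m choose s)\<close>.
  Conversely, if \<open>A\<close> has maximum size \<open>m\<close>, then adding any group element to \<open>A\<close> creates a relation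
  that involves it, so every element is a signed sum of at most \<open>t - 1\<close> elements of \<open>A\<close>. Hence
  \<open>n \<le> (\<Sum>i<t. (m choose i) 2^i)\<close>, and \<open>t!\<close> times this is, term by term, dominated by the binomial
  expansion of \<open>(2 m + t)^t\<close>.
\<close>

lemma weakly_independentD:
  assumes "weakly_independent G t A" "\<And>a. a \<in> A \<Longrightarrow> c a \<in> {-1, 0, 1 :: int}"
    "(\<Sum>a\<in>A. \<bar>c a\<bar>) \<le> int t" "(\<Otimes>\<^bsub>G\<^esub>a\<in>A. a [^]\<^bsub>G\<^esub> c a) = \<one>\<^bsub>G\<^esub>" "a \<in> A"
  shows "c a = 0"
  using assms unfolding weakly_independent_def by blast

section \<open>Binomial estimates and counting of sign patterns\<close>

text \<open>The right-hand side is the falling factorial \<open>m (m - 1) ... (m - s + 1)\<close>,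
  and each of its \<open>s\<close> factors is at least \<open>m - s + 1\<close>. The induction
  splits off the largest factor.\<close>

lemma power_le_fact_mult_binomial:
  fixes m s :: nat
  assumes "s \<le> m"
  shows "(m - s + 1) ^ s \<le> fact s * (m choose s)"
  using assms
proof (induction s arbitrary: m)
  case (Suc s)
  then obtain k where m: "m = Suc k" "s \<le> k"
    by (cases m) auto
  have "(m - Suc s + 1) ^ Suc s = (k - s + 1) * (k - s + 1) ^ s"
    using m by simp
  also have "\<dots> \<le> Suc k * (fact s * (k choose s))"
    using Suc.IH[OF m(2)] by (intro mult_mono) auto
  also have "\<dots> = fact s * (Suc s * (Suc k choose Suc s))"
    by (simp only: Suc_times_binomial_eq[of k s] ac_simps)
  also have "\<dots> = fact (Suc s) * (m choose Suc s)"
    using m by (simp only: fact_Suc of_nat_id mult.assoc mult.left_commute[of "fact s"])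
  finally show ?case .
qed simp

text \<open>Split \<open>t!\<close> as \<open>(t choose i) i! (t - i)!\<close>, then bound
  \<open>i! (m choose i)\<close> by \<open>m^i\<close> and \<open>(t - i)!\<close> by
  \<open>t^(t - i)\<close>.\<close>

lemma fact_binomial_sum_less:
  fixes m t :: nat
  assumes "m > 0" "t > 0"
  shows "fact t * (\<Sum>i<t. (m choose i) * 2 ^ i) < (2 * m + t) ^ t"
proof -
  have term_le: "fact t * ((m choose i) * 2 ^ i) \<le> (t choose i) * (2 * m) ^ i * t ^ (t - i)"
    if "i < t" for i
  proof -
    have "fact t * ((m choose i) * 2 ^ i)
        = (t choose i) * 2 ^ i * (fact i * (m choose i)) * fact (t - i)"
      using binomial_fact_lemma[of i t] that by (simp add: ac_simps)
    also have "\<dots> \<le> (t choose i) * 2 ^ i * m ^ i * t ^ (t - i)"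
    proof (intro mult_mono)
      show "fact i * (m choose i) \<le> m ^ i"
        using binomial_fact_pow[of m i] by (simp add: mult.commute)
      show "fact (t - i) \<le> t ^ (t - i)"
        using fact_le_power[of "t - i", where ?'a = nat] power_mono[of "t - i" t "t - i"] by simp
    qed auto
    finally show ?thesis
      by (simp add: power_mult_distrib mult.assoc)
  qed
  have "fact t * (\<Sum>i<t. (m choose i) * 2 ^ i)
      \<le> (\<Sum>i<t. (t choose i) * (2 * m) ^ i * t ^ (t - i))"
    unfolding sum_distrib_left by (intro sum_mono) (use term_le in auto)
  \<comment> \<open>Strictness comes from the added term \<open>i = t\<close>, which is
    \<open>(2 * m) ^ t > 0\<close>.\<close>
  also have "\<dots> < (\<Sum>i\<le>t. (t choose i) * (2 * m) ^ i * t ^ (t - i))"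
    using assms by (simp add: lessThan_Suc_atMost[symmetric])
  also have "\<dots> = (2 * m + t) ^ t"
    using binomial[of "2 * m" t t] by simp
  finally show ?thesis .
qed

text \<open>A pair \<open>(S, T)\<close> encodes a sign pattern: \<open>S\<close> is the support and
  \<open>T\<close> the set of elements with sign +1. Grouping by \<open>card S = i\<close> gives
  \<open>2 ^ i\<close> patterns on each support.\<close>

lemma card_subset_pairs:
  assumes "finite A"
  shows "card (SIGMA S:{S. S \<subseteq> A \<and> card S < t}. Pow S) = (\<Sum>i<t. (card A choose i) * 2 ^ i)"
proof -
  let ?F = "{S. S \<subseteq> A \<and> card S < t}"
  have fin: "finite ?F" "\<forall>S\<in>?F. finite S"
    using assms by (auto dest: finite_subset)
  have "card (Sigma ?F Pow) = (\<Sum>S\<in>?F. card (Pow S))"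
    using fin by (intro card_SigmaI) blast+
  also have "\<dots> = (\<Sum>S\<in>?F. 2 ^ card S)"
    using fin by (intro sum.cong refl card_Pow) blast
  also have "\<dots> = (\<Sum>i<t. \<Sum>S | S \<in> ?F \<and> card S = i. 2 ^ card S)"
    using fin by (intro sum.group[symmetric]) blast+
  also have "\<dots> = (\<Sum>i<t. (card A choose i) * 2 ^ i)"
  proof (rule sum.cong)
    fix i assume "i \<in> {..<t}"
    then have "{S. S \<in> ?F \<and> card S = i} = {S. S \<subseteq> A \<and> card S = i}"
      by auto
    then show "(\<Sum>S | S \<in> ?F \<and> card S = i. 2 ^ card S) = (card A choose i) * 2 ^ i"
      using n_subsets[OF assms, of i] by simp
  qed simp
  finally show ?thesis .
qed

section \<open>Combinations with integer coefficients\<close>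

context comm_group
begin

lemma finprod_int_pow_diff:
  assumes "A \<subseteq> carrier G"
  shows "(\<Otimes>a\<in>A. a [^] (c a - d a :: int)) \<otimes> (\<Otimes>a\<in>A. a [^] d a) = (\<Otimes>a\<in>A. a [^] c a)"
proof -
  have "(\<Otimes>a\<in>A. a [^] (c a - d a)) \<otimes> (\<Otimes>a\<in>A. a [^] d a)
      = (\<Otimes>a\<in>A. a [^] (c a - d a) \<otimes> a [^] d a)"
    using assms by (intro finprod_multf[symmetric]) auto
  also have "\<dots> = (\<Otimes>a\<in>A. a [^] c a)"
    using assms by (intro finprod_cong') (auto simp: int_pow_mult[symmetric])
  finally show ?thesis .
qed

lemma finprod_int_pow_neg:
  assumes "A \<subseteq> carrier G"
  shows "(\<Otimes>a\<in>A. a [^] (- c a :: int)) = inv (\<Otimes>a\<in>A. a [^] c a)"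
proof -
  have "(\<Otimes>a\<in>A. a [^] (- c a)) \<otimes> (\<Otimes>a\<in>A. a [^] c a) = \<one>"
    using finprod_int_pow_diff[OF assms, of "\<lambda>_. 0" c] by (simp add: finprod_one_eqI)
  then show ?thesis
    using assms by (intro inv_equality[symmetric] finprod_closed) auto
qed

text \<open>Rewrites a subset sum as a 0/1 combination over all of \<open>A\<close>, the form in
  which independence is stated.\<close>

lemma finprod_int_pow_of_bool:
  assumes "finite A" "A \<subseteq> carrier G" "S \<subseteq> A"
  shows "(\<Otimes>a\<in>A. a [^] (of_bool (a \<in> S) :: int)) = (\<Otimes>a\<in>S. a)"
  using assms by (intro finprod_mono_neutral_cong_right) auto

section \<open>Upper bound: distinct subset sums\<close>

lemma weakly_independent_sums_inj_on:
  assumes indep: "weakly_independent G t A" and "2 * s \<le> t"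
  shows "inj_on (\<lambda>S. \<Otimes>a\<in>S. a) {S. S \<subseteq> A \<and> card S = s}"
proof (rule inj_onI, clarify)
  fix S T
  assume S: "S \<subseteq> A" "s = card S" and T: "T \<subseteq> A" "card T = card S"
    and eq: "(\<Otimes>a\<in>S. a) = (\<Otimes>a\<in>T. a)"
  have A: "finite A" "A \<subseteq> carrier G"
    using indep by (auto simp: weakly_independent_def)
  \<comment> \<open>The indicators cancel on \<open>S \<inter> T\<close>, so overlapping sets still
    give coefficients in {-1, 0, 1}; \<open>c\<close> vanishes on \<open>A\<close> only if
    \<open>S = T\<close>.\<close>
  define c :: "'a \<Rightarrow> int" where "c a = of_bool (a \<in> S) - of_bool (a \<in> T)" for a
  have "(\<Otimes>a\<in>A. a [^] c a) \<otimes> (\<Otimes>a\<in>T. a) = (\<Otimes>a\<in>T. a)"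
    using finprod_int_pow_diff[OF A(2), of "\<lambda>a. of_bool (a \<in> S)" "\<lambda>a. of_bool (a \<in> T)"] A S T eq
    by (simp add: finprod_int_pow_of_bool c_def)
  then have one: "(\<Otimes>a\<in>A. a [^] c a) = \<one>"
    using A T by (subst (asm) r_cancel_one) (auto intro!: finprod_closed)
  have "(\<Sum>a\<in>A. \<bar>c a\<bar>) \<le> (\<Sum>a\<in>A. of_bool (a \<in> S) + of_bool (a \<in> T))"
    by (intro sum_mono) (auto simp: c_def)
  also have "\<dots> = int (card S) + int (card T)"
    using A S T by (simp add: sum.distrib sum.If_cases of_bool_def Int_absorb1)
  also have "\<dots> \<le> int t"
    using assms S T by simp
  finally have c_zero: "c a = 0" if "a \<in> A" for a
    using weakly_independentD[OF indep _ _ one that] by (auto simp: c_def)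
  have "a \<in> S \<longleftrightarrow> a \<in> T" if "a \<in> A" for a
    using c_zero[OF that] by (simp add: c_def of_bool_eq_iff)
  then show "S = T"
    using S T by blast
qed

lemma weakly_independent_binomial_le_order:
  assumes "weakly_independent G t A" "finite (carrier G)" "2 * s \<le> t"
  shows "card A choose s \<le> order G"
proof -
  have A: "finite A" "A \<subseteq> carrier G"
    using assms by (auto simp: weakly_independent_def)
  have "card {S. S \<subseteq> A \<and> card S = s} \<le> card (carrier G)"
    using A by (intro card_inj_on_le[OF weakly_independent_sums_inj_on[OF assms(1,3)] _ assms(2)])
      (auto intro!: finprod_closed)
  then show ?thesis
    using A by (simp add: n_subsets order_def)
qed

section \<open>Lower bound: signed sums cover the group\<close>

text \<open>A relation on \<open>insert g A\<close> must involve \<open>g\<close>, or it would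
  contradict the independence of \<open>A\<close>. Solving for \<open>g\<close> removes one unit of
  weight, whence the strict bound; if the coefficient of \<open>g\<close> is 1, all other signs
  flip.\<close>

lemma weakly_independent_maximal_signed_sum:
  assumes indep: "weakly_independent G t A" and g: "g \<in> carrier G" "g \<notin> A"
    and maximal: "\<not> weakly_independent G t (insert g A)"
  obtains c :: "'a \<Rightarrow> int" where "\<And>a. a \<in> A \<Longrightarrow> c a \<in> {-1, 0, 1}"
    "(\<Sum>a\<in>A. \<bar>c a\<bar>) < int t" "g = (\<Otimes>a\<in>A. a [^] c a)"
proof -
  have A: "finite A" "A \<subseteq> carrier G"
    using indep by (auto simp: weakly_independent_def)
  obtain c :: "'a \<Rightarrow> int" where c: "\<forall>a\<in>insert g A. c a \<in> {-1, 0, 1}"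
    and wt: "(\<Sum>a\<in>insert g A. \<bar>c a\<bar>) \<le> int t"
    and one: "(\<Otimes>a\<in>insert g A. a [^] c a) = \<one>"
    and nz: "\<exists>a\<in>insert g A. c a \<noteq> 0"
    using maximal A g unfolding weakly_independent_def by auto
  let ?x = "\<Otimes>a\<in>A. a [^] c a"
  have x: "?x \<in> carrier G"
    using A by (auto intro!: finprod_closed)
  have rel: "g [^] c g \<otimes> ?x = \<one>"
    using one A g by (subst (asm) finprod_insert) auto
  have wt': "\<bar>c g\<bar> + (\<Sum>a\<in>A. \<bar>c a\<bar>) \<le> int t"
    using wt A g by simp
  have "c g \<noteq> 0"
  proof
    assume "c g = 0"
    then have "c a = 0" if "a \<in> A" for a
      using weakly_independentD[OF indep _ _ _ that, of c] c rel wt' x by auto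
    with nz \<open>c g = 0\<close> show False by auto
  qed
  then consider "c g = 1" | "c g = -1"
    using c by auto
  then show thesis
  proof cases
    case 1
    have "g = inv ?x"
      using rel g x 1 by (intro inv_equality[symmetric]) auto
    then show thesis
      using that[of "\<lambda>a. - c a"] c wt' 1 A by (auto simp: finprod_int_pow_neg)
  next
    case 2
    have "inv g \<otimes> ?x = \<one>"
      using rel g 2 by (simp add: int_pow_neg)
    then have "g = ?x"
      using g x by (metis inv_closed inv_inv inv_equality m_comm)
    then show thesis
      using that[of c] c wt' 2 by auto
  qed
qed

text \<open>Coefficient functions are arbitrary outside \<open>A\<close>, so they cannot be counted
  directly. Support and positive part determine the sum and match the pairs of
  \<open>card_subset_pairs\<close>.\<close>

lemma finprod_int_pow_eq_signed_sum:
  fixes c :: "'a \<Rightarrow> int"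
  assumes "finite A" "A \<subseteq> carrier G" and c: "\<And>a. a \<in> A \<Longrightarrow> c a \<in> {-1, 0, 1}"
  shows "(\<Otimes>a\<in>A. a [^] c a)
    = (\<Otimes>a\<in>{a\<in>A. c a \<noteq> 0}. if a \<in> {a\<in>A. c a = 1} then a else inv a)"
proof (rule finprod_mono_neutral_cong_right)
  fix a assume "a \<in> {a\<in>A. c a \<noteq> 0}"
  then show "a [^] c a = (if a \<in> {a\<in>A. c a = 1} then a else inv a)"
    using c[of a] assms(2) by (auto simp: int_pow_neg)
qed (use assms in auto)

lemma order_le_if_maximum_weakly_independent:
  assumes indep: "weakly_independent G t A" and "t \<ge> 2"
    and maximum: "\<And>B. weakly_independent G t B \<Longrightarrow> card B \<le> card A"
  shows "order G \<le> (\<Sum>i<t. (card A choose i) * 2 ^ i)"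
proof -
  have A: "finite A" "A \<subseteq> carrier G"
    using indep by (auto simp: weakly_independent_def)
  let ?I = "SIGMA S:{S. S \<subseteq> A \<and> card S < t}. Pow S"
  let ?f = "\<lambda>(S, T). \<Otimes>a\<in>S. if a \<in> T then a else inv a"
  have "carrier G \<subseteq> ?f ` ?I"
  proof
    fix g assume g: "g \<in> carrier G"
    obtain c :: "'a \<Rightarrow> int" where c: "\<And>a. a \<in> A \<Longrightarrow> c a \<in> {-1, 0, 1}"
      and wt: "(\<Sum>a\<in>A. \<bar>c a\<bar>) < int t" and g_eq: "g = (\<Otimes>a\<in>A. a [^] c a)"
    \<comment> \<open>An element of \<open>A\<close> is a signed sum of weight 1, which is below
      \<open>t\<close> because \<open>t \<ge> 2\<close>. For any other \<open>g\<close>,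
      \<open>insert g A\<close> is too large to be independent.\<close>
    proof (cases "g \<in> A")
      case True
      show thesis
      proof (rule that[of "\<lambda>a. of_bool (a \<in> {g})"])
        show "(\<Sum>a\<in>A. \<bar>of_bool (a \<in> {g}) :: int\<bar>) < int t"
          using A True \<open>t \<ge> 2\<close> by (simp add: of_bool_def if_distrib cong: if_cong)
        show "g = (\<Otimes>a\<in>A. a [^] (of_bool (a \<in> {g}) :: int))"
          using finprod_int_pow_of_bool[OF A, of "{g}"] True g by simp
      qed auto
    next
      case False
      have "\<not> weakly_independent G t (insert g A)"
        using maximum[of "insert g A"] A False by auto
      then show thesis
        using weakly_independent_maximal_signed_sum[OF indep g False] that by blast
    qed
    \<comment> \<open>Every nonzero coefficient contributes at least 1 to the weight, so the support
      has fewer than \<open>t\<close> elements.\<close>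
    have "int (card {a\<in>A. c a \<noteq> 0}) = (\<Sum>a\<in>{a\<in>A. c a \<noteq> 0}. 1)"
      by simp
    also have "\<dots> \<le> (\<Sum>a\<in>A. \<bar>c a\<bar>)"
      using A by (intro sum_le_included[where i = "\<lambda>a. a"]) auto
    finally have "({a\<in>A. c a \<noteq> 0}, {a\<in>A. c a = 1}) \<in> ?I"
      using wt by auto
    moreover have "g = ?f ({a\<in>A. c a \<noteq> 0}, {a\<in>A. c a = 1})"
      unfolding g_eq using finprod_int_pow_eq_signed_sum[OF A c] by simp
    ultimately show "g \<in> ?f ` ?I"
      by (rule rev_image_eqI)
  qed
  moreover have "finite ?I"
    using A by (intro finite_SigmaI) (auto dest: finite_subset)
  ultimately have "order G \<le> card ?I"
    unfolding order_def by (intro surj_card_le)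
  then show ?thesis
    using A by (simp add: card_subset_pairs)
qed

section \<open>Attainment of the maximum\<close>

lemma weakly_independent_singleton:
  assumes "g \<in> carrier G" "g \<noteq> \<one>"
  shows "weakly_independent G t {g}"
  using assms by (auto simp: weakly_independent_def int_pow_neg)

lemma obtains_maximum_weakly_independent:
  assumes "finite (carrier G)" "order G \<ge> 2"
  obtains A where "weakly_independent G t A" "card A = max_weakly_independent G t"
    "\<And>B. weakly_independent G t B \<Longrightarrow> card B \<le> card A"
proof -
  let ?W = "{A. weakly_independent G t A}"
  have "?W \<subseteq> Pow (carrier G)"
    by (auto simp: weakly_independent_def)
  then have fin: "finite (card ` ?W)"
    using assms(1) by (meson finite_Pow_iff finite_imageI finite_subset)
  \<comment> \<open>A non-identity element supplies an independent singleton, so \<open>Max\<close>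
    is taken over a nonempty set.\<close>
  have "\<not> carrier G \<subseteq> {\<one>}"
    using assms(2) card_mono[of "{\<one>}" "carrier G"] by (auto simp: order_def)
  then have "card ` ?W \<noteq> {}"
    using weakly_independent_singleton by blast
  with fin have "Max (card ` ?W) \<in> card ` ?W"
    by (rule Max_in)
  then obtain A where A: "weakly_independent G t A" "card A = Max (card ` ?W)"
    by (auto simp: image_iff)
  moreover have "card B \<le> card A" if "weakly_independent G t B" for B
    using that fin A by auto
  ultimately show thesis
    using that[of A] by (simp add: max_weakly_independent_def)
qed

end

section \<open>Extraction of roots\<close>

theorem theorem18:
  fixes G :: "('a, 'b) monoid_scheme" and n t :: nat
  assumes "comm_group G" and "finite (carrier G)" and "order G = n"
    and "n \<ge> 2" and "t \<ge> 2"
  shows "(fact t / 2 ^ t * real n) powr (1 / real t) - real t / 2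
           < real (max_weakly_independent G t) \<and>
         real (max_weakly_independent G t)
           < (fact (t div 2) * real n) powr (1 / real (t div 2)) + real t / 2"
proof -
  interpret comm_group G by fact
  obtain A where A: "weakly_independent G t A" and card_A: "card A = max_weakly_independent G t"
    and maximum: "\<And>B. weakly_independent G t B \<Longrightarrow> card B \<le> card A"
    using obtains_maximum_weakly_independent assms by blast
  define m where "m = card A"
  have "m > 0"
    using A by (auto simp: weakly_independent_def m_def card_gt_0_iff)
  have "fact t * n \<le> fact t * (\<Sum>i<t. (m choose i) * 2 ^ i)"
    using order_le_if_maximum_weakly_independent[OF A \<open>t \<ge> 2\<close> maximum] assms
    by (simp add: m_def)
  also have "\<dots> < (2 * m + t) ^ t"
    using fact_binomial_sum_less[of m t] \<open>m > 0\<close> \<open>t \<ge> 2\<close> by simp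
  finally have "real (fact t * n) < real ((2 * m + t) ^ t)"
    by (simp only: of_nat_less_iff)
  \<comment> \<open>Division by \<open>2 ^ t\<close> turns the base \<open>2 m + t\<close> into
    \<open>m + t / 2\<close>, which yields the shift in the lower bound.\<close>
  then have "fact t / 2 ^ t * real n < ((2 * real m + real t) / 2) ^ t"
    by (simp add: power_divide field_simps)
  then have "(fact t / 2 ^ t * real n) powr (1 / real t)
      < (((2 * real m + real t) / 2) ^ t) powr (1 / real t)"
    using \<open>t \<ge> 2\<close> by (intro powr_less_mono2) auto
  also have "\<dots> = real m + real t / 2"
    using \<open>t \<ge> 2\<close> \<open>m > 0\<close> by (simp add: powr_realpow[symmetric] powr_powr add_divide_distrib)
  finally have lower: "(fact t / 2 ^ t * real n) powr (1 / real t) - real t / 2 < real m"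
    by simp

  define s where "s = t div 2"
  have s: "s > 0" "2 * s \<le> t"
    using \<open>t \<ge> 2\<close> by (auto simp: s_def)
  have pos: "(fact s * real n) powr (1 / real s) > 0"
    using \<open>n \<ge> 2\<close> by simp
  have "real m < (fact s * real n) powr (1 / real s) + real t / 2"
  \<comment> \<open>The power estimate needs \<open>s \<le> m\<close>, as \<open>m - s\<close> is
    truncated subtraction. Otherwise \<open>m < s \<le> t / 2\<close>, and positivity of the root
    suffices.\<close>
  proof (cases "s \<le> m")
    case True
    have "(m - s + 1) ^ s \<le> fact s * (m choose s)"
      using True by (rule power_le_fact_mult_binomial)
    also have "\<dots> \<le> fact s * n"
      using weakly_independent_binomial_le_order[OF A assms(2) s(2)] assms(3) by (simp add: m_def)
    finally have "real ((m - s + 1) ^ s) \<le> real (fact s * n)"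
      by (simp only: of_nat_le_iff)
    then have "real (m - s + 1) ^ s \<le> fact s * real n"
      by simp
    then have "(real (m - s + 1) ^ s) powr (1 / real s) \<le> (fact s * real n) powr (1 / real s)"
      by (intro powr_mono2) auto
    moreover have "(real (m - s + 1) ^ s) powr (1 / real s) = real (m - s + 1)"
      using s by (simp add: powr_realpow[symmetric] powr_powr)
    \<comment> \<open>The root is at least \<open>m - s + 1\<close>; the extra 1 gives the strict
      inequality, since \<open>s \<le> t / 2\<close>.\<close>
    ultimately show ?thesis
      using s True by simp
  next
    case False
    then have "real m \<le> real t / 2"
      using s by linarith
    with pos show ?thesis
      by linarith
  qed
  with lower show ?thesis
    by (simp add: m_def s_def card_A)
qed

end
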